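(* Let $n\ge 0$ be an integer. Define functions $h^n_0,\dots,h^n_n$ on $[-1,1)$ as follows. For $0\le t<1$ and $0\le i\le n$ put $$h_{n-i}^n(t)=\sum_{k=0}^n d^i_{n,k}\, t^k \quad\text{if } i=0 \text{ or } i \text{ is odd},\qquad h_{n-i}^n(t)=\sum_{k=0}^{n-1} d^{i-1}_{n-1,k}\, t^k \quad\text{if } i>0 \text{ is even},$$ where, for $0\le k\le n$ and $i=0$ or $i$ odd, $$d^i_{n,k}=(-1)^n\frac{\sqrt{2n-2i+1}}{(-n)_i}\,\frac{(-n)_k(n-i+1)_k}{(1)_k(1)_k}\prod_{m=0}^{\frac{i-1}{2}}(n+k+1-2m)\prod_{m=0}^{\frac{i-3}{2}}(n-k-1-2m).$$ Extend each $h^n_i$ to $[-1,0)$ by $h^n_i(-t)=(-1)^{i+1}h^n_i(t)$ for $t\in(0,1)$ (and by continuity at $t=-1$). Then the functions $h^n_0,\dots,h^n_n$ satisfy: (i) on each of $[-1,0)$ and $[0,1)$, $h^n_i$ is a polynomial of degree at most $n$, for $0\le i\le n$; (ii) $\int_{-1}^1 t^s h^n_i(t)\,dt=0$ for all integers $0\le s\le n$, $0\le i\le n$; (iii) $\int_{-1}^1 h^n_i(t)h^n_j(t)\,dt=2\delta_{i,j}$ for $0\le i,j\le n$; (iv) $h^n_i(-t)=(-1)^{i+1}h^n_i(t)$ for $t\in(0,1)$, $0\le i\le n$; (v) $\int_0^1 t^s h^n_i(t)\,dt=0$ for all integers $0\le s<i$, $0\le i\le n$.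
   Context: Notation: $(a)_0=1$ and $(a)_m=a(a+1)\cdots(a+m-1)$ for integers $m>0$. An empty product equals $1$ (in particular, for $i=0$ both products in $d^i_{n,k}$ equal $1$, and for $i=1$ the second product equals $1$). $\delta_{i,j}$ is the Kronecker delta. *)

theory Defs
  imports "HOL-Analysis.Analysis" "HOL-Computational_Algebra.Polynomial"
begin

(* The coefficient d^i_{n,k}; it is only used for i = 0 or i odd, and i, k <= n.
   The bounds are those of the products over 0 <= m <= (i-1)/2 and 0 <= m <= (i-3)/2:
   for odd i these have (i+1)/2 and (i-1)/2 factors, and for i = 0 both are empty.
   The factors are computed in the reals: those of the second product may be negative. *)
definition d_coeff :: "nat \<Rightarrow> nat \<Rightarrow> nat \<Rightarrow> real" where
  "d_coeff n i k =
     (-1) ^ n * (sqrt (2 * real n - 2 * real i + 1) / pochhammer (- real n) i)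
     * (pochhammer (- real n) k * pochhammer (real n - real i + 1) k
        / (pochhammer 1 k * pochhammer 1 k))
     * (\<Prod>m<(i + 1) div 2. real n + real k + 1 - 2 * real m)
     * (\<Prod>m<(i - 1) div 2. real n - real k - 1 - 2 * real m)"

(* The polynomial expression giving h^n_{n-i} on [0,1). *)
definition h_right :: "nat \<Rightarrow> nat \<Rightarrow> real \<Rightarrow> real" where
  "h_right n i t =
     (if i = 0 \<or> odd i then (\<Sum>k\<le>n. d_coeff n i k * t ^ k)
      else (\<Sum>k<n. d_coeff (n - 1) (i - 1) k * t ^ k))"

(* The function h^n_j, for j <= n; only its values on [-1,1) are meaningful. At t = -1 the
   second branch evaluates the polynomial expression at 1, which is the value given by
   continuity; on (-1,0) it is the extension h^n_j(-t) = (-1)^(j+1) h^n_j(t). *)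
definition h_fun :: "nat \<Rightarrow> nat \<Rightarrow> real \<Rightarrow> real" where
  "h_fun n j t =
     (if 0 \<le> t then h_right n (n - j) t
      else (-1) ^ (j + 1) * h_right n (n - j) (- t))"

end

theory Submission
  imports Defs
begin

text \<open>
  Fix \<open>n\<close> and write \<open>h\<^sub>j t = (\<Sum>k\<le>n. c\<^sub>j k * t ^ k)\<close> on \<open>[0,1)\<close>, with moments
  \<open>M\<^sub>j s = (\<Sum>k\<le>n. c\<^sub>j k / (s + k + 1))\<close>, the integral of \<open>t ^ s * h\<^sub>j t\<close> over \<open>[0,1]\<close>.
  Everything follows from a triangular pattern with a parity twist, for \<open>k, s \<le> n\<close>:

  \<^item> \<open>M\<^sub>j s = 0\<close> if \<open>s < j\<close> or \<open>s + j\<close> is odd (\<open>half_moment_eq_0\<close>);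
  \<^item> \<open>c\<^sub>j k = 0\<close> unless \<open>k \<le> j\<close> or \<open>k + j\<close> is odd (\<open>half_coeff_eq_0\<close>);
  \<^item> \<open>c\<^sub>j j * M\<^sub>j j = 1\<close> (\<open>half_coeff_times_moment\<close>).

  Reflection multiplies \<open>t ^ s * h\<^sub>j t\<close> by \<open>(-1) ^ (s + j + 1)\<close>, so over \<open>[-1,1]\<close> the moments with
  \<open>s + j\<close> even cancel by symmetry and the others vanish already on the half interval.
  Likewise the product of \<open>h\<^sub>i\<close> and \<open>h\<^sub>j\<close> is odd or even according to the parity of \<open>i + j\<close>. In the
  even case with \<open>i \<le> j\<close>, the integral over \<open>[0,1]\<close> is \<open>(\<Sum>k\<le>n. c\<^sub>i k * M\<^sub>j k)\<close>, where for
  each \<open>k\<close> one of the two factors is zero, except for \<open>k = i = j\<close>.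

  The pattern is read off from product formulas. The coefficients have the form
  \<open>C * (-1) ^ k * (n choose k) * R k\<close> for a completely factored polynomial \<open>R\<close> of degree at
  most \<open>n\<close> (\<open>value_poly\<close>), with \<open>n - 1\<close> in place of \<open>n\<close> throughout if \<open>n - j > 0\<close> is even. For such
  sums partial fractions give
  \<open>(\<Sum>k\<le>n. (-1) ^ k * (n choose k) * R k / (x + k)) = fact n * R (-x) / pochhammer x (n + 1)\<close>
  (\<open>alternating_binomial_sum_poly\<close>). At \<open>x = s + 1\<close> this turns the zeros of \<open>R\<close> at negative
  integers into vanishing moments, while its zeros at natural numbers are vanishing coefficients.
  The normalization is an evaluation of both products at \<open>k = s = j\<close>.
\<close>

section \<open>Alternating binomial sums of rational functions\<close>

text \<open>Pascal's rule: up to sign, the sums are iterated differences of \<open>g\<close>.\<close>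

lemma alternating_binomial_sum_Suc:
  fixes g :: "nat \<Rightarrow> real"
  shows "(\<Sum>k\<le>Suc n. (-1) ^ k * real (Suc n choose k) * g k) =
    (\<Sum>k\<le>n. (-1) ^ k * real (n choose k) * g k) - (\<Sum>k\<le>n. (-1) ^ k * real (n choose k) * g (Suc k))"
proof -
  have "(\<Sum>k\<le>Suc n. (-1) ^ k * real (Suc n choose k) * g k) =
     g 0 + (\<Sum>k\<le>n. (-1) ^ Suc k * real (Suc n choose Suc k) * g (Suc k))"
    by (subst sum.atMost_Suc_shift) simp
  also have "\<dots> = g 0 + (\<Sum>k\<le>n. (-1) ^ Suc k * real (n choose Suc k) * g (Suc k))
      - (\<Sum>k\<le>n. (-1) ^ k * real (n choose k) * g (Suc k))"
    by (simp add: algebra_simps sum.distrib sum_subtractf sum_negf)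
  also have "g 0 + (\<Sum>k\<le>n. (-1) ^ Suc k * real (n choose Suc k) * g (Suc k)) =
      (\<Sum>k\<le>Suc n. (-1) ^ k * real (n choose k) * g k)"
    by (subst sum.atMost_Suc_shift) simp
  also have "\<dots> = (\<Sum>k\<le>n. (-1) ^ k * real (n choose k) * g k)"
    by simp
  finally show ?thesis .
qed

lemma alternating_binomial_sum_inverse:
  fixes x :: real
  assumes "x > 0"
  shows "(\<Sum>k\<le>n. (-1) ^ k * real (n choose k) * (1 / (x + real k))) =
    fact n / pochhammer x (Suc n)"
  using assms
proof (induction n arbitrary: x)
  case 0
  then show ?case by simp
next
  case (Suc n)
  define P where "P = pochhammer (x + 1) n"
  have P: "P > 0"
    unfolding P_def using Suc.prems by (intro pochhammer_pos) auto
  have 1: "pochhammer x (Suc n) = x * P" "pochhammer (x + 1) (Suc n) = P * (x + 1 + n)"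
    "pochhammer x (Suc (Suc n)) = x * (P * (x + 1 + n))"
    unfolding P_def pochhammer_rec[of x n] pochhammer_rec[of x "Suc n"] pochhammer_Suc[of "x + 1" n]
    by simp_all
  have "(\<Sum>k\<le>Suc n. (-1) ^ k * real (Suc n choose k) * (1 / (x + real k))) =
      fact n / pochhammer x (Suc n) - fact n / pochhammer (x + 1) (Suc n)"
    using Suc.IH[of x] Suc.IH[of "x + 1"] Suc.prems
    by (subst alternating_binomial_sum_Suc) (simp add: algebra_simps)
  also have "\<dots> = fact (Suc n) / pochhammer x (Suc (Suc n))"
  proof -
    define D where "D = x + 1 + real n"
    have "D > 0" using Suc.prems by (simp add: D_def)
    then have "fact n / (x * P) - fact n / (P * D) = fact n * (D - x) / (x * (P * D))"
      using P Suc.prems by (simp add: field_simps)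
    also have "fact n * (D - x) = fact (Suc n)"
      by (simp add: D_def algebra_simps)
    finally show ?thesis
      unfolding 1 D_def .
  qed
  finally show ?case .
qed

text \<open>Dividing \<open>q\<close> by \<open>k + x\<close> leaves the constant remainder \<open>q (-x)\<close> and a quotient of degree
  below \<open>n\<close>, which the \<open>n\<close>-th difference annihilates. The induction reaches this without
  forming the quotient: it splits off the constant term of \<open>q\<close> and absorbs the remaining factor
  \<open>k\<close> into the binomial coefficient.\<close>

lemma alternating_binomial_sum_poly:
  fixes x :: real
  assumes "x > 0" and "degree q \<le> n"
  shows "(\<Sum>k\<le>n. (-1) ^ k * real (n choose k) * (poly q (real k) / (x + real k))) =
    fact n * poly q (- x) / pochhammer x (Suc n)"
  using assms
proof (induction n arbitrary: x q)
  case 0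
  then obtain a where "q = [:a:]"
    by (metis degree_eq_zeroE le_zero_eq)
  then show ?case by simp
next
  case (Suc n)
  obtain a r where q: "q = pCons a r"
    by (cases q)
  have deg: "degree (pcompose r [:1, 1:]) \<le> n"
    using Suc.prems(2) unfolding q by (auto simp: degree_pcompose split: if_splits)
  have pos: "pochhammer (x + 1) (Suc n) > 0"
    using Suc.prems by (intro pochhammer_pos) auto
  have absorb: "(\<Sum>k\<le>Suc n. (-1) ^ k * real (Suc n choose k) * (real k * poly r k / (x + real k))) =
      - real (Suc n) *
        (\<Sum>k\<le>n. (-1) ^ k * real (n choose k) * (poly (pcompose r [:1, 1:]) k / (x + 1 + real k)))"
  proof -
    have *: "real (Suc n choose Suc k) * real (Suc k) = real (Suc n) * real (n choose k)" for k
      by (metis Suc_times_binomial_eq of_nat_mult mult.commute)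
    have "(-1) ^ Suc k * real (Suc n choose Suc k) * (real (Suc k) * poly r (Suc k) / (x + real (Suc k)))
        = - real (Suc n) *
          ((-1) ^ k * real (n choose k) * (poly (pcompose r [:1, 1:]) k / (x + 1 + real k)))" for k
    proof -
      have "(-1) ^ Suc k * real (Suc n choose Suc k) * (real (Suc k) * poly r (Suc k) / (x + real (Suc k)))
        = (-1) ^ Suc k * (real (Suc n choose Suc k) * real (Suc k)) * (poly r (Suc k) / (x + real (Suc k)))"
        by (simp add: mult_ac)
      also have "\<dots> = - real (Suc n) *
          ((-1) ^ k * real (n choose k) * (poly (pcompose r [:1, 1:]) k / (x + 1 + real k)))"
        unfolding * by (simp add: poly_pcompose add_ac mult_ac del: of_nat_Suc) (simp add: add_ac)
      finally show ?thesis .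
    qed
    then show ?thesis
      by (subst sum.atMost_Suc_shift) (simp add: sum_distrib_left)
  qed
  have "(\<Sum>k\<le>Suc n. (-1) ^ k * real (Suc n choose k) * (poly q (real k) / (x + real k))) =
      a * (\<Sum>k\<le>Suc n. (-1) ^ k * real (Suc n choose k) * (1 / (x + real k))) +
      (\<Sum>k\<le>Suc n. (-1) ^ k * real (Suc n choose k) * (real k * poly r k / (x + real k)))"
    unfolding q sum_distrib_left sum.distrib[symmetric]
    by (intro sum.cong) (simp_all add: algebra_simps add_divide_distrib del: binomial_Suc_Suc)
  also have "\<dots> = a * (fact (Suc n) / pochhammer x (Suc (Suc n))) -
      real (Suc n) * (fact n * poly r (- x) / pochhammer (x + 1) (Suc n))"
    unfolding absorb alternating_binomial_sum_inverse[OF Suc.prems(1)]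
    using Suc.IH[OF _ deg, of "x + 1"] Suc.prems(1) by (simp add: poly_pcompose del: of_nat_Suc)
  also have "\<dots> = fact (Suc n) * poly q (- x) / pochhammer x (Suc (Suc n))"
    unfolding pochhammer_rec[of x "Suc n"] using pos Suc.prems(1)
    by (simp add: q field_simps del: pochhammer_Suc)
  finally show ?case .
qed

section \<open>Coefficients as values of a polynomial at the integers\<close>

text \<open>The polynomial in \<open>k\<close> that remains of \<open>d_coeff n i k\<close> after the sign, the binomial coefficient
  and all factors independent of \<open>k\<close> are removed: since
  \<open>pochhammer (n - i + 1) k / fact k = pochhammer (k + 1) (n - i) / fact (n - i)\<close> for \<open>i \<le> n\<close>,
  that quotient is a polynomial in \<open>k\<close> as well; the first product is its numerator.\<close>

definition value_poly :: "nat \<Rightarrow> nat \<Rightarrow> real poly" where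
  "value_poly n i = (\<Prod>l<n - i. [:1 + real l, 1:])
     * (\<Prod>m<(i + 1) div 2. [:real n + 1 - 2 * real m, 1:])
     * (\<Prod>m<(i - 1) div 2. [:real n - 1 - 2 * real m, -1:])"

lemma poly_value_poly:
  "poly (value_poly n i) x = pochhammer (x + 1) (n - i)
     * (\<Prod>m<(i + 1) div 2. real n + x + 1 - 2 * real m)
     * (\<Prod>m<(i - 1) div 2. real n - x - 1 - 2 * real m)"
  unfolding value_poly_def
  by (simp add: poly_prod pochhammer_prod atLeast0LessThan algebra_simps)

text \<open>For odd \<open>i\<close> the three products have \<open>n - i\<close>, \<open>(i + 1) / 2\<close> and \<open>(i - 1) / 2\<close> linear factors,
  which add up to \<open>n\<close>, the largest degree that the partial fraction formula allows.\<close>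

lemma degree_value_poly:
  assumes "i \<le> n" and "i = 0 \<or> odd i"
  shows "degree (value_poly n i) \<le> n"
proof -
  have prod_of_linear: "degree (\<Prod>m<r. [:a m, b m:]) \<le> r" for r :: nat and a b :: "nat \<Rightarrow> real"
  proof -
    have "degree (\<Prod>m<r. [:a m, b m:]) \<le> (\<Sum>m<r. degree [:a m, b m:])"
      using degree_prod_sum_le[of "{..<r}" "\<lambda>m. [:a m, b m:]"] by simp
    also have "\<dots> \<le> (\<Sum>m<r. 1)"
      by (intro sum_mono) simp
    finally show ?thesis by simp
  qed
  have "degree (value_poly n i) \<le> (n - i) + (i + 1) div 2 + (i - 1) div 2"
    unfolding value_poly_def
    by (intro degree_mult_le[THEN order_trans] add_mono prod_of_linear)
  also have "\<dots> = n"
    using assms by (auto elim!: oddE)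
  finally show ?thesis .
qed

definition norming_factor :: "nat \<Rightarrow> nat \<Rightarrow> real" where
  "norming_factor n i =
     (-1) ^ n * sqrt (2 * real n - 2 * real i + 1) / (pochhammer (- real n) i * fact (n - i))"

lemma pochhammer_minus_nat:
  "pochhammer (- real n) k = (-1) ^ k * fact k * real (n choose k)"
  by (simp add: binomial_gbinomial gbinomial_pochhammer flip: power_mult_distrib)

lemma d_coeff_eq_value_poly:
  assumes "i \<le> n"
  shows "d_coeff n i k =
    norming_factor n i * ((-1) ^ k * real (n choose k) * poly (value_poly n i) (real k))"
proof -
  have "pochhammer 1 (n - i) * pochhammer (1 + real (n - i)) k = pochhammer (1::real) (n - i + k)"
    by (simp add: pochhammer_product')
  also have "\<dots> = pochhammer 1 k * pochhammer (1 + real k) (n - i)"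
    by (subst add.commute) (simp add: pochhammer_product')
  finally have "pochhammer (real n - real i + 1) k / fact k =
      pochhammer (real k + 1) (n - i) / fact (n - i)"
    using assms by (simp add: pochhammer_fact[symmetric] field_simps of_nat_diff)
  moreover have "pochhammer (- real n) k / fact k = (-1) ^ k * real (n choose k)"
    by (simp add: pochhammer_minus_nat)
  ultimately have *: "pochhammer (- real n) k * pochhammer (real n - real i + 1) k
        / (pochhammer 1 k * pochhammer 1 k)
      = (-1) ^ k * real (n choose k) * (pochhammer (real k + 1) (n - i) / fact (n - i))"
    by (metis pochhammer_fact times_divide_times_eq)
  show ?thesis
    unfolding d_coeff_def * poly_value_poly norming_factor_def by simp
qed

lemma d_coeff_moment:
  assumes "i \<le> n" and "i = 0 \<or> odd i"
  shows "(\<Sum>k\<le>n. d_coeff n i k / real (s + k + 1)) =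
    norming_factor n i * (fact n * poly (value_poly n i) (- real s - 1) / pochhammer (real s + 1) (Suc n))"
proof -
  have "(\<Sum>k\<le>n. d_coeff n i k / real (s + k + 1)) = norming_factor n i *
     (\<Sum>k\<le>n. (-1) ^ k * real (n choose k) *
       (poly (value_poly n i) (real k) / (real s + 1 + real k)))"
    unfolding sum_distrib_left
    by (intro sum.cong) (simp_all add: d_coeff_eq_value_poly[OF assms(1)] add_ac)
  also have "\<dots> = norming_factor n i *
      (fact n * poly (value_poly n i) (- real s - 1) / pochhammer (real s + 1) (Suc n))"
    using degree_value_poly[OF assms] by (subst alternating_binomial_sum_poly) auto
  finally show ?thesis .
qed

text \<open>At \<open>-s - 1\<close> the Pochhammer factor becomes \<open>pochhammer (-s) (n - i)\<close>, with zeros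
  \<open>s < n - i\<close>, and the second product has the factors \<open>n - s - 2 * m\<close>, with zeros
  \<open>s = n, n - 2, \<dots>, n - i + 1\<close>.\<close>

lemma d_coeff_moment_eq_0:
  assumes "i \<le> n" and "i = 0 \<or> odd i"
    and s: "s < n - i \<or> (odd i \<and> s \<le> n \<and> even (n + s))"
  shows "(\<Sum>k\<le>n. d_coeff n i k / real (s + k + 1)) = 0"
proof -
  have "poly (value_poly n i) (- real s - 1) = 0"
  proof (cases "s < n - i")
    case True
    then have "pochhammer (- real s) (n - i) = 0"
      by (auto simp: pochhammer_eq_0_iff)
    then show ?thesis by (simp add: poly_value_poly)
  next
    case False
    with s have "odd i" "s \<le> n" "even (n + s)" "n - s \<le> i"
      by auto
    \<comment> \<open>The vanishing factor is \<open>n - s - 2 * m\<close> for \<open>2 * m = n - s\<close>; parity makes \<open>n - s < i\<close>.\<close>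
    define m where "m = (n - s) div 2"
    have "real n - real s - 2 * real m = 0" "m < (i + 1) div 2"
      using \<open>odd i\<close> \<open>s \<le> n\<close> \<open>even (n + s)\<close> \<open>n - s \<le> i\<close> unfolding m_def
      by (auto elim!: oddE simp: real_of_nat_div of_nat_diff)
    then have "(\<Prod>m<(i + 1) div 2. real n + (- real s - 1) + 1 - 2 * real m) = 0"
      by (intro prod_zero) auto
    then show ?thesis
      unfolding poly_value_poly by simp
  qed
  then show ?thesis
    unfolding d_coeff_moment[OF assms(1,2)] by simp
qed

text \<open>The factors \<open>n - k - 1 - 2 * m\<close> of the last product vanish at \<open>k = n - 1, n - 3, \<dots>, n - i + 2\<close>.\<close>

lemma d_coeff_eq_0:
  assumes "odd i" "i \<le> n" "n - i < k" "k \<le> n" "odd (n - k)"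
  shows "d_coeff n i k = 0"
proof -
  obtain m where m: "n - k = 2 * m + 1"
    using assms(5) by (rule oddE)
  obtain r where r: "i = 2 * r + 1"
    using assms(1) by (rule oddE)
  have "m < (i - 1) div 2"
    using m r assms(2,3) by auto
  moreover have "real n - real k - 1 - 2 * real m = 0"
    using m assms(4) by (simp add: of_nat_diff[symmetric])
  ultimately have "(\<Prod>m<(i - 1) div 2. real n - real k - 1 - 2 * real m) = 0"
    by (intro prod_zero) auto
  then show ?thesis
    by (simp add: d_coeff_def)
qed

section \<open>Normalization\<close>

text \<open>The two products in \<open>value_poly\<close> run in steps of two. Pairing the first one at one argument
  with the second one at the other argument fills the gaps and yields ordinary factorials.\<close>

lemma prod_interleave:
  fixes y :: real
  assumes "i = 0 \<or> odd i"
  shows "(\<Prod>m<(i + 1) div 2. y - 2 * real m) * (\<Prod>m<(i - 1) div 2. y - 1 - 2 * real m) =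
    (\<Prod>l<i. y - real l)"
proof (cases "i = 0")
  case False
  then obtain r where "i = 2 * r + 1"
    using assms by (auto elim: oddE)
  moreover have "(\<Prod>m<Suc r. y - 2 * real m) * (\<Prod>m<r. y - 1 - 2 * real m) =
      (\<Prod>l<2 * r + 1. y - real l)"
  proof (induction r)
    case (Suc r)
    have "(\<Prod>m<Suc (Suc r). y - 2 * real m) * (\<Prod>m<Suc r. y - 1 - 2 * real m) =
      ((\<Prod>m<Suc r. y - 2 * real m) * (\<Prod>m<r. y - 1 - 2 * real m)) *
        ((y - 1 - 2 * real r) * (y - 2 * real (Suc r)))"
      by (simp only: prod.lessThan_Suc mult_ac)
    also have "\<dots> = (\<Prod>l<2 * Suc r + 1. y - real l)"
      unfolding Suc.IH by (simp add: algebra_simps)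
    finally show ?case .
  qed simp
  ultimately show ?thesis by simp
qed simp

lemma prod_falling_fact:
  assumes "i \<le> N"
  shows "(\<Prod>l<i. real N - real l) * fact (N - i) = fact N"
  using assms
proof (induction i)
  case (Suc i)
  then have "N - i = Suc (N - Suc i)" by simp
  then have "(fact (N - i) :: real) = (real N - real i) * fact (N - Suc i)"
    using Suc.prems by (simp only: fact_Suc) (simp add: of_nat_diff)
  with Suc show ?case by (simp add: mult_ac)
qed simp

text \<open>For \<open>p = n - i\<close>, the coefficient contributes the products \<open>A\<close> and \<open>B\<close> and the moment the products
  \<open>A'\<close> and \<open>B'\<close>. Crosswise, \<open>A * B' = fact (n + p + 1) / fact (2 * p + 1)\<close> and \<open>A' * B = fact i\<close>,
  so all factors become factorials and cancel; the square root in the definition supplies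
  \<open>2 * p + 1\<close>, which turns \<open>fact (2 * p)\<close> into \<open>fact (2 * p + 1)\<close>.\<close>

lemma d_coeff_times_moment:
  assumes "i \<le> n" and i: "i = 0 \<or> odd i"
  shows "d_coeff n i (n - i) * (\<Sum>k\<le>n. d_coeff n i k / real (n - i + k + 1)) = 1"
proof -
  define p where "p = n - i"
  have n: "n = p + i"
    using assms by (simp add: p_def)
  define A where "A = (\<Prod>m<(i + 1) div 2. real (n + p + 1) - 2 * real m)"
  define B where "B = (\<Prod>m<(i - 1) div 2. real i - 1 - 2 * real m)"
  define A' where "A' = (\<Prod>m<(i + 1) div 2. real i - 2 * real m)"
  define B' where "B' = (\<Prod>m<(i - 1) div 2. real (n + p + 1) - 1 - 2 * real m)"
  have V: "poly (value_poly n i) (real p) = pochhammer (real p + 1) p * A * B"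
    unfolding poly_value_poly A_def B_def by (simp add: n algebra_simps)
  have V': "poly (value_poly n i) (- real p - 1) = pochhammer (- real p) p * A' * B'"
    unfolding poly_value_poly A'_def B'_def by (simp add: n algebra_simps)
  have AB': "A * B' * fact (2 * p + 1) = fact (n + p + 1)"
  proof -
    have "n + p + 1 - i = 2 * p + 1" "i \<le> n + p + 1"
      by (simp_all add: n)
    then show ?thesis
      unfolding A_def B'_def prod_interleave[OF i]
      using prod_falling_fact[of i "n + p + 1"] by (simp only:)
  qed
  have A'B: "A' * B = fact i"
    using prod_interleave[OF i, of "real i"] prod_falling_fact[of i i]
    unfolding A'_def B_def by simp
  have poch: "pochhammer (real p + 1) r = fact (p + r) / fact p" for r
    using pochhammer_product'[of "1::real" p r]
    by (simp add: pochhammer_fact[symmetric] add.commute)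
  have ni: "pochhammer (- real n) i = (-1) ^ i * fact n / fact p"
    "real (n choose p) = fact n / (fact p * fact i)"
    using binomial_fact[of i n, where 'a = real] binomial_fact[of p n, where 'a = real] unfolding pochhammer_minus_nat
    by (simp_all add: n)
  have pp: "pochhammer (- real p) p = (-1) ^ p * fact p"
    by (simp add: pochhammer_minus_nat)
  have C: "norming_factor n i ^ 2 = (2 * real p + 1) / (fact n) ^ 2"
    unfolding norming_factor_def ni
    by (simp add: n power_mult_distrib power_divide flip: power_mult)
  have cancel: "q / a\<^sup>2 * (g * (a / (b * c)) * (d / b) * (a * (g * b) / (f / b)) * (f / e) * c) =
      (g * g) * (q * d / e)"
    if "a \<noteq> 0" "b \<noteq> 0" "c \<noteq> 0" "f \<noteq> 0" for a b c d e f g q :: real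
    using that by (simp add: power2_eq_square)
  have "d_coeff n i p * (\<Sum>k\<le>n. d_coeff n i k / real (p + k + 1)) =
    norming_factor n i ^ 2 * ((-1) ^ p * real (n choose p) * (pochhammer (real p + 1) p * A * B)
      * (fact n * (pochhammer (- real p) p * A' * B') / pochhammer (real p + 1) (Suc n)))"
    unfolding d_coeff_moment[OF assms] d_coeff_eq_value_poly[OF assms(1), of p] V V'
    by (simp add: power2_eq_square mult_ac)
  also have "\<dots> = norming_factor n i ^ 2 * ((-1) ^ p * real (n choose p) * (fact (p + p) / fact p)
      * (fact n * ((-1) ^ p * fact p) / (fact (p + Suc n) / fact p)) * (A * B') * (A' * B))"
    unfolding poch pp by (simp add: mult_ac)
  also have "A * B' = fact (p + Suc n) / fact (2 * p + 1)"
    using AB' by (simp add: field_simps del: fact_Suc)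
  also have "norming_factor n i ^ 2 * ((-1) ^ p * real (n choose p) * (fact (p + p) / fact p)
      * (fact n * ((-1) ^ p * fact p) / (fact (p + Suc n) / fact p))
      * (fact (p + Suc n) / fact (2 * p + 1)) * (A' * B)) =
      ((-1) ^ p * (-1) ^ p) * ((2 * real p + 1) * fact (2 * p) / fact (2 * p + 1))"
    unfolding C A'B ni mult_2 by (rule cancel) simp_all
  also have "(2 * real p + 1) * fact (2 * p) = fact (2 * p + 1)"
    by (simp add: algebra_simps)
  also have "(-1) ^ p * (-1) ^ p * (fact (2 * p + 1) / fact (2 * p + 1)) = (1::real)"
    by (simp del: fact_Suc flip: power_mult_distrib)
  finally show ?thesis
    by (simp add: p_def)
qed

section \<open>A triangular pattern common to all parities\<close>

text \<open>Indexing by \<open>j = n - i\<close> and padding with a zero coefficient of \<open>t ^ n\<close> when \<open>i > 0\<close> is even makes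
  the three cases of the construction obey the same rules below: passing from \<open>(n, i)\<close> to
  \<open>(n - 1, i - 1)\<close> keeps \<open>j\<close> and shifts the parity of \<open>n\<close> along with that of \<open>i\<close>.\<close>

definition half_coeff :: "nat \<Rightarrow> nat \<Rightarrow> nat \<Rightarrow> real" where
  "half_coeff n j k =
     (if n - j = 0 \<or> odd (n - j) then d_coeff n (n - j) k
      else if k < n then d_coeff (n - 1) (n - j - 1) k else 0)"

definition half_moment :: "nat \<Rightarrow> nat \<Rightarrow> nat \<Rightarrow> real" where
  "half_moment n j s = (\<Sum>k\<le>n. half_coeff n j k / real (s + k + 1))"

lemma sum_half_coeff:
  assumes "\<not> (n - j = 0 \<or> odd (n - j))"
  shows "(\<Sum>k\<le>n. half_coeff n j k * f k) = (\<Sum>k<n. d_coeff (n - 1) (n - j - 1) k * f k)"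
  unfolding half_coeff_def if_not_P[OF assms] lessThan_Suc_atMost[symmetric] sum.lessThan_Suc
  by simp

lemma h_right_eq: "h_right n (n - j) t = (\<Sum>k\<le>n. half_coeff n j k * t ^ k)"
proof (cases "n - j = 0 \<or> odd (n - j)")
  case True
  then show ?thesis by (simp add: h_right_def half_coeff_def)
next
  case False
  then show ?thesis
    by (subst sum_half_coeff) (auto simp: h_right_def)
qed

lemma half_moment_even:
  assumes "j \<le> n" "\<not> (n - j = 0 \<or> odd (n - j))"
  shows "half_moment n j s = (\<Sum>k\<le>n - 1. d_coeff (n - 1) (n - j - 1) k / real (s + k + 1))"
proof -
  have "{..<n} = {..n - 1}"
    using assms by (cases n) auto
  then show ?thesis
    unfolding half_moment_def
    using sum_half_coeff[OF assms(2), of "\<lambda>k. 1 / real (s + k + 1)"] by simp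
qed

text \<open>The polynomial of degree below \<open>n\<close> used for even \<open>n - j > 0\<close> has no reason to be orthogonal to
  \<open>t ^ n\<close>, but \<open>s = n\<close> is then excluded by parity.\<close>

lemma half_moment_eq_0:
  assumes "j \<le> n" "s \<le> n" "s < j \<or> odd (s + j)"
  shows "half_moment n j s = 0"
proof (cases "n - j = 0 \<or> odd (n - j)")
  case True
  have "(\<Sum>k\<le>n. d_coeff n (n - j) k / real (s + k + 1)) = 0"
  proof (rule d_coeff_moment_eq_0)
    show "s < n - (n - j) \<or> odd (n - j) \<and> s \<le> n \<and> even (n + s)"
      using assms True by (cases "j = n") (auto simp: nat_less_le)
  qed (use True in auto)
  then show ?thesis
    using True by (simp add: half_moment_def half_coeff_def)
next
  case False
  have "s \<noteq> n \<or> s < j"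
    using assms False by auto
  then show ?thesis
    unfolding half_moment_even[OF assms(1) False]
    using assms False by (intro d_coeff_moment_eq_0) auto
qed

lemma half_coeff_eq_0:
  assumes "j \<le> n" "k \<le> n" "j < k" "even (k + j)"
  shows "half_coeff n j k = 0"
proof (cases "n - j = 0 \<or> odd (n - j)")
  case True
  then show ?thesis
    using assms by (auto simp: half_coeff_def intro!: d_coeff_eq_0)
next
  case False
  show ?thesis
  proof (cases "k < n")
    case True
    then show ?thesis
      using False assms by (auto simp: half_coeff_def intro!: d_coeff_eq_0)
  qed (use False in \<open>auto simp: half_coeff_def\<close>)
qed

lemma half_coeff_times_moment:
  assumes "j \<le> n"
  shows "half_coeff n j j * half_moment n j j = 1"
proof (cases "n - j = 0 \<or> odd (n - j)")
  case True
  then show ?thesis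
    using d_coeff_times_moment[of "n - j" n] assms by (simp add: half_coeff_def half_moment_def)
next
  case False
  then have "n - 1 - (n - j - 1) = j" "j < n"
    using assms by auto
  then show ?thesis
    unfolding half_moment_even[OF assms False]
    using d_coeff_times_moment[of "n - j - 1" "n - 1"] False by (simp add: half_coeff_def)
qed

text \<open>The parity assumption lets the odd case of both vanishing rules refer to the same \<open>k\<close>: a
  coefficient with \<open>k > j'\<close> survives only if \<open>k + j'\<close>, hence \<open>k + j\<close>, is odd, and then the moment
  vanishes. A coefficient with \<open>k \<le> j' \<le> j\<close> meets a zero moment unless \<open>k = j\<close>.\<close>

lemma half_orthonormal_le:
  assumes "j' \<le> j" "j \<le> n" "even (j + j')"
  shows "(\<Sum>k\<le>n. half_coeff n j' k * half_moment n j k) = (if j = j' then 1 else 0)"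
proof -
  have "half_coeff n j' k * half_moment n j k = (if k = j \<and> j = j' then 1 else 0)" if "k \<le> n" for k
  proof (cases "k = j \<and> j = j'")
    case True
    then show ?thesis using half_coeff_times_moment assms by auto
  next
    case False
    then consider "k < j \<or> odd (k + j)" | "j' < k" "even (k + j')"
      using assms by (cases "k < j \<or> odd (k + j)") auto
    then show ?thesis
      using False assms that half_moment_eq_0[of j n k] half_coeff_eq_0[of j' n k]
      by cases auto
  qed
  then have "(\<Sum>k\<le>n. half_coeff n j' k * half_moment n j k) =
      (\<Sum>k\<le>n. if k = j \<and> j = j' then 1 else 0)"
    by (intro sum.cong) auto
  also have "\<dots> = (if j = j' then 1 else 0)"
    using assms by auto
  finally show ?thesis .
qed

section \<open>Integrals over the half interval and over the whole interval\<close>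

lemma has_integral_power_times_sum:
  fixes c :: "nat \<Rightarrow> real"
  shows "((\<lambda>t. t ^ s * (\<Sum>k\<le>n. c k * t ^ k)) has_integral (\<Sum>k\<le>n. c k / real (s + k + 1))) {0..1}"
proof -
  have "((\<lambda>t. c k * t ^ (s + k)) has_integral c k * (1 / real (s + k + 1))) {0..1}" for k
  proof (rule has_integral_mult_right)
    have "((\<lambda>t. t ^ (s + k)) has_integral
        1 ^ Suc (s + k) / real (Suc (s + k)) - 0 ^ Suc (s + k) / real (Suc (s + k))) {0..1::real}"
      by (intro fundamental_theorem_of_calculus)
        (auto intro!: derivative_eq_intros simp: has_real_derivative_iff_has_vector_derivative[symmetric]
           simp del: power_Suc of_nat_Suc)
    then show "((\<lambda>t. t ^ (s + k)) has_integral 1 / real (s + k + 1)) {0..1::real}"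
      by simp
  qed
  then have "((\<lambda>t. \<Sum>k\<le>n. c k * t ^ (s + k)) has_integral (\<Sum>k\<le>n. c k * (1 / real (s + k + 1)))) {0..1}"
    by (intro has_integral_sum) auto
  then show ?thesis
    by (simp add: sum_distrib_left power_add mult_ac)
qed

lemma h_fun_moment:
  "((\<lambda>t. t ^ s * h_fun n j t) has_integral half_moment n j s) {0..1}"
proof -
  have "((\<lambda>t. t ^ s * h_right n (n - j) t) has_integral half_moment n j s) {0..1}"
    unfolding h_right_eq half_moment_def by (rule has_integral_power_times_sum)
  then show ?thesis
    by (rule has_integral_eq[rotated]) (simp add: h_fun_def)
qed

lemma h_fun_product:
  "((\<lambda>t. h_fun n j t * h_fun n j' t) has_integral
     (\<Sum>k\<le>n. half_coeff n j' k * half_moment n j k)) {0..1}"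
proof -
  have "((\<lambda>t. \<Sum>k\<le>n. half_coeff n j' k * (t ^ k * h_fun n j t)) has_integral
     (\<Sum>k\<le>n. half_coeff n j' k * half_moment n j k)) {0..1}"
    by (intro has_integral_sum has_integral_mult_right h_fun_moment) auto
  then show ?thesis
    by (rule has_integral_eq[rotated])
      (simp add: h_fun_def[of n j'] h_right_eq sum_distrib_left mult_ac)
qed

lemma h_fun_product_half:
  assumes "j \<le> n" "j' \<le> n" "even (j + j')"
  shows "((\<lambda>t. h_fun n j t * h_fun n j' t) has_integral (if j = j' then 1 else 0)) {0..1}"
proof (cases "j' \<le> j")
  case True
  then show ?thesis
    using h_fun_product[of n j j'] half_orthonormal_le[of j' j n] assms by simp
next
  case False
  then show ?thesis
    using h_fun_product[of n j' j] half_orthonormal_le[of j j' n] assms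
    by (simp add: mult.commute add.commute)
qed

lemma h_fun_minus:
  assumes "t \<in> {0<..<1}"
  shows "h_fun n j (- t) = (-1) ^ (j + 1) * h_fun n j t"
  using assms by (simp add: h_fun_def)

text \<open>The symmetry is required only inside the open interval, because \<open>h_fun\<close> need not satisfy it at
  \<open>t = 0\<close>.\<close>

lemma has_integral_reflect_extend:
  fixes F :: "real \<Rightarrow> real"
  assumes I: "(F has_integral I) {0..1}"
    and refl: "\<And>t. t \<in> {0<..<1} \<Longrightarrow> F (- t) = e * F t"
  shows "(F has_integral (1 + e) * I) {-1..1}"
proof -
  have "((\<lambda>t. F (- t)) has_integral e * I) {0..1}"
  proof (rule has_integral_spike_finite[where S = "{0, 1}"])
    show "((\<lambda>t. e * F t) has_integral e * I) {0..1}"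
      using I by (rule has_integral_mult_right)
  qed (use refl in auto)
  then have "(F has_integral e * I) {-1..0}"
    by (intro has_integral_reflect_real[where f = F and a = "-1" and b = 0, THEN iffD1]) simp
  from has_integral_combine[OF _ _ this I] show ?thesis
    by (simp add: algebra_simps)
qed

lemma h_fun_piecewise_poly:
  shows "\<exists>p :: real poly. degree p \<le> n \<and> (\<forall>t\<in>{-1..<0}. h_fun n j t = poly p t)"
    and "\<exists>q :: real poly. degree q \<le> n \<and> (\<forall>t\<in>{0..<1}. h_fun n j t = poly q t)"
proof -
  define q where "q = (\<Sum>k\<le>n. monom (half_coeff n j k) k)"
  have q: "degree q \<le> n" "h_right n (n - j) t = poly q t" for t
    unfolding q_def h_right_eq
    by (auto simp: poly_sum poly_monom intro!: degree_sum_le degree_monom_le[THEN order_trans])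
  define p where "p = smult ((-1) ^ (j + 1)) (pcompose q [:0, -1:])"
  have "degree p \<le> n"
    using q(1) unfolding p_def by (simp add: degree_pcompose)
  moreover have "\<forall>t\<in>{-1..<0}. h_fun n j t = poly p t"
    by (auto simp: h_fun_def q(2) p_def poly_pcompose)
  ultimately show "\<exists>p :: real poly. degree p \<le> n \<and> (\<forall>t\<in>{-1..<0}. h_fun n j t = poly p t)"
    by blast
  show "\<exists>q :: real poly. degree q \<le> n \<and> (\<forall>t\<in>{0..<1}. h_fun n j t = poly q t)"
    using q by (intro exI[of _ q]) (auto simp: h_fun_def)
qed

lemma h_fun_moment_full:
  assumes "s \<le> n" "j \<le> n"
  shows "((\<lambda>t. t ^ s * h_fun n j t) has_integral 0) {-1..1}"
proof -
  have "(- t) ^ s * h_fun n j (- t) = (-1) ^ (s + j + 1) * (t ^ s * h_fun n j t)"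
    if "t \<in> {0<..<1}" for t
    using h_fun_minus[OF that] power_minus[of t s] by (simp add: power_add)
  from has_integral_reflect_extend[OF h_fun_moment this]
  have "((\<lambda>t. t ^ s * h_fun n j t) has_integral (1 + (-1) ^ (s + j + 1)) * half_moment n j s) {-1..1}" .
  moreover have "(1 + (-1) ^ (s + j + 1)) * half_moment n j s = 0"
    using half_moment_eq_0[of j n s] assms by (cases "even (s + j)") auto
  ultimately show ?thesis by (simp only:)
qed

lemma h_fun_product_full:
  assumes "i \<le> n" "j \<le> n"
  shows "((\<lambda>t. h_fun n i t * h_fun n j t) has_integral (2 * (if i = j then 1 else 0))) {-1..1}"
proof -
  have "h_fun n i (- t) * h_fun n j (- t) = (-1) ^ (i + j) * (h_fun n i t * h_fun n j t)"
    if "t \<in> {0<..<1}" for t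
    using h_fun_minus[OF that] by (simp add: power_add)
  from has_integral_reflect_extend[OF h_fun_product this]
  have *: "((\<lambda>t. h_fun n i t * h_fun n j t) has_integral
      (1 + (-1) ^ (i + j)) * (\<Sum>k\<le>n. half_coeff n j k * half_moment n i k)) {-1..1}" .
  show ?thesis
  proof (cases "even (i + j)")
    case True
    with * have "((\<lambda>t. h_fun n i t * h_fun n j t) has_integral
      2 * (\<Sum>k\<le>n. half_coeff n j k * half_moment n i k)) {-1..1}"
      by simp
    moreover have "(\<Sum>k\<le>n. half_coeff n j k * half_moment n i k) = (if i = j then 1 else 0)"
      using has_integral_unique[OF h_fun_product h_fun_product_half] assms True by blast
    ultimately show ?thesis by simp
  next
    case False
    with * show ?thesis by (auto split: if_splits)
  qed
qed

theorem theorem1: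
  fixes n :: nat
  shows
    "(\<forall>i\<le>n.
        (\<exists>p :: real poly. degree p \<le> n \<and> (\<forall>t\<in>{-1..<0}. h_fun n i t = poly p t)) \<and>
        (\<exists>q :: real poly. degree q \<le> n \<and> (\<forall>t\<in>{0..<1}. h_fun n i t = poly q t)))
   \<and> (\<forall>s\<le>n. \<forall>i\<le>n. ((\<lambda>t. t ^ s * h_fun n i t) has_integral 0) {-1..1})
   \<and> (\<forall>i\<le>n. \<forall>j\<le>n.
        ((\<lambda>t. h_fun n i t * h_fun n j t) has_integral (2 * (if i = j then 1 else 0))) {-1..1})
   \<and> (\<forall>i\<le>n. \<forall>t\<in>{0<..<1}. h_fun n i (- t) = (-1) ^ (i + 1) * h_fun n i t)
   \<and> (\<forall>i\<le>n. \<forall>s<i. ((\<lambda>t. t ^ s * h_fun n i t) has_integral 0) {0..1})"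
proof (intro conjI allI impI ballI)
  fix i s assume "i \<le> n" "s < i"
  then show "((\<lambda>t. t ^ s * h_fun n i t) has_integral 0) {0..1}"
    using h_fun_moment[of s n i] half_moment_eq_0[of i n s] by simp
qed (rule h_fun_piecewise_poly h_fun_moment_full h_fun_product_full h_fun_minus; assumption)+

end
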